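(* For any nonnegative integer $m$ and any integer $r\ge1$, \[ \sum_{\substack{s_1+\cdots+s_r=m\\ s_i\ge 0}}\rho(s_1+1,\ldots,s_{r-1}+1,s_r+2)=\frac{\zeta^\star_{m+1}(\{1\}^{r-1})}{(m+1)(m+1)!}=\frac{1}{(m+1)(m+1)!}P_{r-1}\bigl(H^{(1)}_{m+1},H^{(2)}_{m+1},\ldots,H^{(r-1)}_{m+1}\bigr). \]
   Context: The rising factorial is $(x)_0=1$, $(x)_n=x(x+1)\cdots(x+n-1)$. For nonnegative integers $\alpha_1,\ldots,\alpha_r$ with $\alpha_r\ge1$, the multiple $\rho$-value is \[ \rho(\alpha_1+1,\ldots,\alpha_r+1)=\sum_{1\le n_1<\cdots<n_r}\prod_{j=1}^{r}\frac{1}{(n_j+\alpha_1+\cdots+\alpha_{j-1})_{\alpha_j+1}}. \] For integers $n\ge1$, $k\ge0$: $\zeta^\star_n(\{1\}^k)=\sum_{1\le k_1\le k_2\le\cdots\le k_k\le n}\frac{1}{k_1k_2\cdots k_k}$ (equal to $1$ when $k=0$). $H_n^{(s)}=\sum_{j=1}^n j^{-s}$. The polynomials $P_m$ are defined by $\exp\bigl(\sum_{k\ge1}\frac{t_k}{k}z^k\bigr)=\sum_{m\ge0}P_m(t_1,\ldots,t_m)z^m$, i.e. $P_m(t_1,\ldots,t_m)=\sum_{k_1+2k_2+\cdots+mk_m=m,\,k_i\ge0}\prod_{i=1}^m\frac{1}{k_i!}\left(\frac{t_i}{i}\right)^{k_i}$, with $P_0=1$. *)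

theory Defs
  imports "HOL-Analysis.Analysis" "HOL-Computational_Algebra.Formal_Power_Series"
begin

text \<open>
  The list \<open>ks\<close> holds the arguments \<open>k\<^sub>j = \<alpha>\<^sub>j + 1\<close> (all at least 1, the last one at least 2), so
  the shift \<open>\<alpha>\<^sub>1 + \<cdots> + \<alpha>\<^sub>j\<^sub>-\<^sub>1\<close> is the sum of the preceding \<open>k\<^sub>i - 1\<close>, and the rising factorial
  has \<open>\<alpha>\<^sub>j + 1 = k\<^sub>j\<close> factors. All terms are positive, so the unordered sum over the increasing
  tuples \<open>ns\<close> has the same value as the iterated series.
\<close>

definition rho :: "nat list \<Rightarrow> real" where
  "rho ks =
    (\<Sum>\<^sub>\<infinity>ns\<in>{ns :: nat list. length ns = length ks \<and> sorted_wrt (<) ns \<and> (\<forall>n\<in>set ns. 1 \<le> n)}.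
      \<Prod>j<length ks. 1 / pochhammer (real (ns ! j + (\<Sum>i<j. ks ! i - 1))) (ks ! j))"

definition zeta_star_ones :: "nat \<Rightarrow> nat \<Rightarrow> real" where
  "zeta_star_ones n k =
    (\<Sum>ks\<in>{ks :: nat list. length ks = k \<and> sorted ks \<and> set ks \<subseteq> {1..n}}.
      1 / (\<Prod>i<k. real (ks ! i)))"

definition gen_harm :: "nat \<Rightarrow> nat \<Rightarrow> real" where
  "gen_harm n s = (\<Sum>j=1..n. 1 / real j ^ s)"

text \<open>
  \<open>P m t\<close> is \<open>P\<^sub>m(t\<^sub>1, \<dots>, t\<^sub>m)\<close>, the coefficient of \<open>z\<^sup>m\<close> in the formal power series
  \<open>exp (\<Sum>k\<ge>1. t\<^sub>k / k * z\<^sup>k)\<close>. The sequence \<open>t\<close> is indexed from 1: \<open>t 0\<close> is not used, and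
  the values beyond \<open>t m\<close> have no influence, see \<open>P_cong\<close> below.
\<close>

definition P :: "nat \<Rightarrow> (nat \<Rightarrow> real) \<Rightarrow> real" where
  "P m t = fps_nth (fps_exp 1 oo Abs_fps (\<lambda>k. if k = 0 then 0 else t k / real k)) m"

lemma fps_power_nth_cong:
  fixes f g :: "real fps"
  assumes "\<And>k. k \<le> m \<Longrightarrow> fps_nth f k = fps_nth g k" and "k \<le> m"
  shows "fps_nth (f ^ i) k = fps_nth (g ^ i) k"
  using assms(2)
proof (induction i arbitrary: k)
  case (Suc i)
  then show ?case
    using assms(1) by (auto simp: fps_mult_nth intro!: sum.cong)
qed simp

lemma P_cong:
  assumes "\<And>k. 1 \<le> k \<Longrightarrow> k \<le> m \<Longrightarrow> t k = u k"
  shows "P m t = P m u"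
  unfolding P_def fps_compose_nth
  by (intro sum.cong refl arg_cong2[where f = "(*)"] fps_power_nth_cong[where m = m])
     (use assms in auto)

end

theory Submission imports Defs begin

text \<open>
  Shifting all summation variables by \<open>a\<close> and restricting them to \<open>n\<^sub>1 > N\<close> generalises the sum to one
  with the closed form \<open>\<zeta>\<^sup>\<star>\<^sub>m\<^sub>+\<^sub>1({1}\<^sup>r\<^sup>-\<^sup>1) / ((m + 1) (N + a + 1)\<^sub>m\<^sub>+\<^sub>1)\<close>. This is proved by induction on \<open>r\<close>:
  removing \<open>n\<^sub>1 = n\<close> and \<open>s\<^sub>1 = s\<close> leaves the same sum with \<open>N = n\<close>, shift \<open>a + s\<close> and total \<open>m - s\<close>.
  Its rising factorial combines with that of the removed factor to \<open>(n + a)\<^sub>m\<^sub>+\<^sub>2\<close>, which does not depend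
  on \<open>s\<close>, so the sum over \<open>n\<close> telescopes and the sum over \<open>s\<close> is the recursion of \<open>\<zeta>\<^sup>\<star>\<close>.

  For the second equality, both \<open>\<Sum>k. \<zeta>\<^sup>\<star>\<^sub>n({1}\<^sup>k) z\<^sup>k\<close> and \<open>exp (\<Sum>k. H\<^sub>n\<^sup>(\<^sup>k\<^sup>) z\<^sup>k / k)\<close> get divided by
  \<open>1 - z / n\<close> when passing from \<open>n - 1\<close> to \<open>n\<close>.
\<close>

subsection \<open>The recursion of the star values\<close>

lemma finite_sorted_lists:
  "finite {ks :: nat list. length ks = k \<and> sorted ks \<and> set ks \<subseteq> {1..n}}"
  by (rule finite_subset[OF _ finite_lists_length_eq[of "{1..n}" k]]) auto

lemma zeta_star_ones_0 [simp]: "zeta_star_ones n 0 = 1"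
proof -
  have "{ks :: nat list. length ks = 0 \<and> sorted ks \<and> set ks \<subseteq> {1..n}} = {[]}"
    by auto
  then show ?thesis
    by (simp add: zeta_star_ones_def)
qed

text \<open>Split off the last, hence largest, entry \<open>j\<close>: the remaining
  \<open>k\<close> entries form an arbitrary weakly increasing list with values in
  \<open>{1..j}\<close>.\<close>

lemma zeta_star_ones_Suc:
  "zeta_star_ones n (Suc k) = (\<Sum>j=1..n. zeta_star_ones j k / real j)"
proof -
  let ?A = "\<lambda>n k. {ks :: nat list. length ks = k \<and> sorted ks \<and> set ks \<subseteq> {1..n}}"
  have eq: "?A n (Suc k) = (\<lambda>(j, ks). ks @ [j]) ` Sigma {1..n} (\<lambda>j. ?A j k)" (is "_ = ?B")
  proof (intro equalityI subsetI)
    fix ks assume ks: "ks \<in> ?A n (Suc k)"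
    then obtain ks' j where "ks = ks' @ [j]"
      by (cases ks rule: rev_cases) auto
    with ks show "ks \<in> ?B"
      by (auto simp: sorted_append image_iff subset_iff)
  qed (auto simp: sorted_append subset_iff)
  have inj: "inj_on (\<lambda>(j, ks). ks @ [j]) (Sigma {1..n} (\<lambda>j. ?A j k))"
    by (auto simp: inj_on_def)
  have "zeta_star_ones n (Suc k) =
      (\<Sum>(j, ks)\<in>Sigma {1..n} (\<lambda>j. ?A j k). 1 / (\<Prod>i<Suc k. real ((ks @ [j]) ! i)))"
    unfolding zeta_star_ones_def eq by (subst sum.reindex[OF inj]) (simp add: case_prod_unfold)
  also have "\<dots> = (\<Sum>j=1..n. \<Sum>ks\<in>?A j k. 1 / (\<Prod>i<Suc k. real ((ks @ [j]) ! i)))"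
    by (subst sum.Sigma) (use finite_sorted_lists in auto)
  also have "\<dots> = (\<Sum>j=1..n. zeta_star_ones j k / real j)"
    unfolding zeta_star_ones_def sum_divide_distrib
    by (intro sum.cong refl) (auto simp: nth_append)
  finally show ?thesis .
qed

subsection \<open>The generating function of the star values\<close>

text \<open>This is the series of -(log(1 - z/1) + ... + log(1 - z/n)), so its exponential should be
  the product of the series 1 / (1 - z/j).\<close>

definition harm_fps :: "nat \<Rightarrow> real fps" where
  "harm_fps n = Abs_fps (\<lambda>k. if k = 0 then 0 else gen_harm n k / real k)"

lemma P_gen_harm: "P k (gen_harm n) = fps_nth (fps_exp 1 oo harm_fps n) k"
  by (simp add: P_def harm_fps_def)

text \<open>Comparing coefficients of z^m expresses (m + 1) times coefficient m + 1 through the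
  coefficients up to m, so the constant term determines the whole solution.\<close>

lemma fps_linear_ODE_unique:
  fixes f g a :: "real fps"
  assumes "fps_deriv f = a * f" "fps_deriv g = a * g" "fps_nth f 0 = fps_nth g 0"
  shows "f = g"
proof (rule fps_ext)
  fix n show "fps_nth f n = fps_nth g n"
  proof (induction n rule: less_induct)
    case (less n)
    show ?case
    proof (cases n)
      case (Suc m)
      have "real (Suc m) * fps_nth h (Suc m) = (\<Sum>i=0..m. fps_nth a i * fps_nth h (m - i))"
        if "fps_deriv h = a * h" for h
        using arg_cong[OF that, of "\<lambda>u. fps_nth u m"] by (simp add: fps_mult_nth)
      moreover have "(\<Sum>i=0..m. fps_nth a i * fps_nth f (m - i)) =
          (\<Sum>i=0..m. fps_nth a i * fps_nth g (m - i))"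
        using less Suc by (intro sum.cong) auto
      ultimately have "real (Suc m) * fps_nth f (Suc m) = real (Suc m) * fps_nth g (Suc m)"
        using assms(1,2) by metis
      then show ?thesis
        using Suc by (metis mult_cancel_left of_nat_eq_0_iff nat.distinct(1))
    qed (use assms in simp)
  qed
qed

lemma fps_deriv_exp_compose:
  fixes f :: "real fps"
  assumes "fps_nth f 0 = 0"
  shows "fps_deriv (fps_exp 1 oo f) = fps_deriv f * (fps_exp 1 oo f)"
  using assms by (simp add: fps_compose_deriv mult.commute)

text \<open>With q = 1/(n + 1), the two series differ by the sum of q^k z^k / k, whose derivative is
  the geometric series q / (1 - q z). Clearing the denominator avoids inverses of power
  series.\<close>

lemma fps_deriv_harm_fps_Suc:
  "(fps_deriv (harm_fps (Suc n)) - fps_deriv (harm_fps n)) * (1 - fps_const (1 / real (Suc n)) * fps_X)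
    = fps_const (1 / real (Suc n))"
proof -
  have D: "fps_deriv (harm_fps (Suc n)) - fps_deriv (harm_fps n) = Abs_fps (\<lambda>k. (1 / real (Suc n)) ^ Suc k)"
    by (rule fps_ext)
      (simp add: harm_fps_def gen_harm_def power_divide field_simps del: of_nat_Suc power_Suc)
  show ?thesis
  proof (rule fps_ext)
    fix k
    show "fps_nth ((fps_deriv (harm_fps (Suc n)) - fps_deriv (harm_fps n)) *
        (1 - fps_const (1 / real (Suc n)) * fps_X)) k = fps_nth (fps_const (1 / real (Suc n))) k"
      unfolding D right_diff_distrib mult_1_right mult.assoc[symmetric]
      by (cases k) (simp_all del: of_nat_Suc)
  qed
qed

text \<open>Both sides have constant term 1 and solve y' = a y with a =
  \<open>fps_deriv (harm_fps n)\<close>.\<close>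

lemma exp_harm_fps_Suc:
  "(fps_exp 1 oo harm_fps (Suc n)) * (1 - fps_const (1 / real (Suc n)) * fps_X)
    = fps_exp 1 oo harm_fps n"
proof -
  define E where "E = (\<lambda>n. fps_exp 1 oo harm_fps n)"
  define q where "q = fps_const (1 / real (Suc n))"
  have E: "fps_deriv (E i) = fps_deriv (harm_fps i) * E i" for i
    unfolding E_def by (rule fps_deriv_exp_compose) (simp add: harm_fps_def)
  have q: "fps_deriv (harm_fps (Suc n)) * (1 - q * fps_X) = fps_deriv (harm_fps n) * (1 - q * fps_X) + q"
    using fps_deriv_harm_fps_Suc[of n] unfolding q_def[symmetric] by (simp add: algebra_simps)
  have dq: "fps_deriv (1 - q * fps_X) = - q"
    by (simp add: q_def)
  \<comment> \<open>The term \<open>- E (Suc n) * q\<close> from differentiating the linear factor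
    cancels the summand \<open>q\<close> on the right of the preceding identity.\<close>
  have "fps_deriv (E (Suc n) * (1 - q * fps_X)) =
      E (Suc n) * (fps_deriv (harm_fps (Suc n)) * (1 - q * fps_X)) - E (Suc n) * q"
    unfolding fps_deriv_mult E dq by (simp add: algebra_simps)
  also have "\<dots> = fps_deriv (harm_fps n) * (E (Suc n) * (1 - q * fps_X))"
    unfolding q by (simp add: algebra_simps)
  finally have "E (Suc n) * (1 - q * fps_X) = E n"
    by (rule fps_linear_ODE_unique[OF _ E]) (simp add: E_def)
  then show ?thesis
    by (simp add: E_def q_def)
qed

text \<open>At z^(k+1) this isolates the term j = n + 1 in the recursion of
  \<open>zeta_star_ones (Suc n) (Suc k)\<close>.\<close>

lemma zeta_star_ones_fps_Suc:
  "Abs_fps (zeta_star_ones (Suc n)) * (1 - fps_const (1 / real (Suc n)) * fps_X)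
    = Abs_fps (zeta_star_ones n)"
proof (rule fps_ext)
  fix k
  show "fps_nth (Abs_fps (zeta_star_ones (Suc n)) * (1 - fps_const (1 / real (Suc n)) * fps_X)) k
      = fps_nth (Abs_fps (zeta_star_ones n)) k"
    unfolding right_diff_distrib mult_1_right mult.assoc[symmetric]
    by (cases k) (simp_all add: zeta_star_ones_Suc del: of_nat_Suc)
qed

lemma zeta_star_ones_eq_P: "zeta_star_ones n k = P k (gen_harm n)"
proof -
  have "Abs_fps (zeta_star_ones n) = fps_exp 1 oo harm_fps n"
  proof (induction n)
    case 0
    have "harm_fps 0 = 0"
      by (rule fps_ext) (simp add: harm_fps_def gen_harm_def)
    moreover have "zeta_star_ones 0 k = (if k = 0 then 1 else 0)" for k
      by (cases k) (simp_all add: zeta_star_ones_Suc)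
    ultimately show ?case
      by (intro fps_ext) simp
  next
    case (Suc n)
    let ?q = "1 - fps_const (1 / real (Suc n)) * fps_X"
    have "fps_nth ?q 0 \<noteq> 0"
      by simp
    then have "?q \<noteq> 0"
      by (metis fps_zero_nth)
    moreover have "Abs_fps (zeta_star_ones (Suc n)) * ?q = (fps_exp 1 oo harm_fps (Suc n)) * ?q"
      unfolding zeta_star_ones_fps_Suc exp_harm_fps_Suc by (rule Suc)
    ultimately show ?case
      by simp
  qed
  then show ?thesis
    by (metis P_gen_harm fps_nth_Abs_fps)
qed

subsection \<open>Sums over compositions and increasing tuples\<close>

definition compositions :: "nat \<Rightarrow> nat \<Rightarrow> nat list set" where
  "compositions r m = {s. length s = r \<and> sum_list s = m}"

definition increasing :: "nat \<Rightarrow> nat \<Rightarrow> nat list set" where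
  "increasing r N = {ns. length ns = r \<and> sorted_wrt (<) ns \<and> (\<forall>n\<in>set ns. N < n)}"

lemma finite_compositions: "finite (compositions r m)"
  by (rule finite_subset[OF _ finite_lists_length_eq[of "{..m}" r]])
    (auto simp: compositions_def intro: member_le_sum_list)

lemma compositions_1: "compositions (Suc 0) m = {[m]}"
  by (auto simp: compositions_def length_Suc_conv)

lemma sum_compositions_Suc:
  "(\<Sum>s\<in>compositions (Suc r) m. f s) = (\<Sum>i\<le>m. \<Sum>s\<in>compositions r (m - i). f (i # s))"
proof -
  have eq: "compositions (Suc r) m = (\<lambda>(i, s). i # s) ` Sigma {..m} (\<lambda>i. compositions r (m - i))"
    by (force simp: compositions_def length_Suc_conv image_iff)
  have "inj_on (\<lambda>(i, s). i # s) (Sigma {..m} (\<lambda>i. compositions r (m - i)))"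
    by (auto simp: inj_on_def)
  then have "sum f (compositions (Suc r) m) =
      (\<Sum>(i, s)\<in>Sigma {..m} (\<lambda>i. compositions r (m - i)). f (i # s))"
    unfolding eq by (subst sum.reindex) (auto simp: case_prod_unfold)
  also have "\<dots> = (\<Sum>i\<le>m. \<Sum>s\<in>compositions r (m - i). f (i # s))"
    by (subst sum.Sigma) (auto simp: finite_compositions)
  finally show ?thesis .
qed

text \<open>Tonelli for splitting off the smallest entry: since \<open>f\<close> is nonnegative,
  convergence of the iterated sums already gives summability over all tuples.\<close>

lemma has_sum_increasing_Suc:
  fixes f :: "nat list \<Rightarrow> real"
  assumes f: "\<And>n. N < n \<Longrightarrow> ((\<lambda>ns. f (n # ns)) has_sum g n) (increasing r n)"
    and g: "(g has_sum S) {N<..}" and nonneg: "\<And>ns. 0 \<le> f ns"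
  shows "(f has_sum S) (increasing (Suc r) N)"
proof -
  have eq: "increasing (Suc r) N = (\<lambda>(n, ns). n # ns) ` Sigma {N<..} (increasing r)"
    by (force simp: increasing_def length_Suc_conv image_iff)
  have inj: "inj_on (\<lambda>(n, ns). n # ns) (Sigma {N<..} (increasing r))"
    by (auto simp: inj_on_def)
  have "((\<lambda>p. f (fst p # snd p)) has_sum S) (Sigma {N<..} (increasing r))"
  proof (rule has_sum_SigmaI)
    show "(\<lambda>p. f (fst p # snd p)) summable_on Sigma {N<..} (increasing r)"
      by (rule summable_on_SigmaI[where g = g])
        (use f g nonneg in \<open>auto intro: has_sum_imp_summable\<close>)
  qed (use f g in auto)
  then show ?thesis
    unfolding eq has_sum_reindex[OF inj] by (simp add: o_def case_prod_unfold)
qed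

lemma has_sum_sum:
  fixes f :: "'a \<Rightarrow> 'b \<Rightarrow> real"
  assumes "finite I" "\<And>i. i \<in> I \<Longrightarrow> (f i has_sum c i) A"
  shows "((\<lambda>x. \<Sum>i\<in>I. f i x) has_sum (\<Sum>i\<in>I. c i)) A"
  using assms by (induction I rule: finite_induct) (auto intro: has_sum_add)

text \<open>Each \<open>f i\<close> is dominated by the total and hence summable. This recovers the
  individual \<open>rho\<close> values from a convergence statement about their sum only.\<close>

lemma sum_infsum_nonneg:
  fixes f :: "'a \<Rightarrow> 'b \<Rightarrow> real"
  assumes "finite I" and S: "((\<lambda>x. \<Sum>i\<in>I. f i x) has_sum S) A" and nonneg: "\<And>i x. 0 \<le> f i x"
  shows "(\<Sum>i\<in>I. infsum (f i) A) = S"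
proof (rule has_sum_unique[OF has_sum_sum S])
  show "(f i has_sum infsum (f i) A) A" if "i \<in> I" for i
    by (rule has_sum_infsum, rule summable_on_comparison_test[OF has_sum_imp_summable[OF S]])
      (use assms that in \<open>auto intro: member_le_sum\<close>)
qed (rule assms)

lemma has_sum_inverse_pochhammer:
  "((\<lambda>n. 1 / pochhammer (real (n + a)) (m + 2)) has_sum
     1 / (real (m + 1) * pochhammer (real (N + a + 1)) (m + 1))) {N<..}"
proof -
  \<comment> \<open>Telescoping rests on 1/(x)_{m+2} = (1/(x)_{m+1} - 1/(x+1)_{m+1}) / (m+1), used
    at x = N + a + 1 + i.\<close>
  define h where "h = (\<lambda>i. 1 / (real (m + 1) * pochhammer (real (N + a + 1 + i)) (m + 1)))"
  have pos: "pochhammer (real (N + a + 1 + i)) k > 0" for i k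
    by (rule pochhammer_pos) simp
  have "h i - h (Suc i) = 1 / pochhammer (real (N + a + 1 + i)) (m + 2)" for i
  proof -
    define x where "x = real (N + a + 1 + i)"
    define p where "p = pochhammer (x + 1) m"
    have x: "x > 0" and p: "p > 0"
      using pos[of "Suc i" m] by (simp_all add: x_def p_def add_ac)
    have e: "real (N + a + 1 + Suc i) = x + 1" "real (N + a + 1 + i) = x"
      by (simp_all add: x_def)
    have 1: "pochhammer x (m + 1) = x * p" "pochhammer (x + 1) (m + 1) = (x + 1 + real m) * p"
      by (simp add: p_def pochhammer_rec, simp add: p_def pochhammer_rec' mult.commute)
    have 2: "pochhammer x (m + 2) = x * ((x + 1 + real m) * p)"
      using 1(2) by (simp add: pochhammer_rec)
    define M where "M = real (m + 1)"
    have M: "M > 0" "x + 1 + real m = x + M"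
      by (simp_all add: M_def)
    show ?thesis
      unfolding h_def e 1 2 M(2) M_def[symmetric] using x p M(1)
      by (simp add: divide_simps)
  qed
  moreover have "h \<longlonglongrightarrow> 0"
  proof (rule tendsto_sandwich[OF _ _ tendsto_const lim_1_over_n])
    show "eventually (\<lambda>i. h i \<le> 1 / of_nat i) sequentially"
    proof (rule eventually_sequentiallyI[of 1])
      fix i :: nat assume i: "1 \<le> i"
      \<comment> \<open>The first factor of the longer rising factorial is at least \<open>i\<close>
        and the other \<open>m\<close> are at least 1, so \<open>h i\<close> is at most 1/i.\<close>
      have "1 \<le> pochhammer (real (N + a + 1 + i) + 1) m"
        unfolding pochhammer_prod by (rule prod_ge_1) simp
      then have "real i \<le> pochhammer (real (N + a + 1 + i)) (m + 1)"
        using mult_mono[of "real i" "real (N + a + 1 + i)" 1] by (simp add: pochhammer_rec)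
      then have "real i \<le> real (m + 1) * pochhammer (real (N + a + 1 + i)) (m + 1)"
        using mult_mono[of 1 "real (m + 1)" "real i"] by simp
      then show "h i \<le> 1 / of_nat i"
        unfolding h_def using i by (intro divide_left_mono) auto
    qed
    show "eventually (\<lambda>i. 0 \<le> h i) sequentially"
      unfolding h_def using pos by (intro always_eventually allI) (simp add: less_imp_le)
  qed
  ultimately have "(\<lambda>i. 1 / pochhammer (real (N + a + 1 + i)) (m + 2)) sums (h 0 - 0)"
    using telescope_sums'[of h 0] by simp
  then have "((\<lambda>i. 1 / pochhammer (real (N + a + 1 + i)) (m + 2)) has_sum h 0) UNIV"
    using pos by (intro sums_nonneg_imp_has_sum) (simp_all add: less_imp_le)
  also have "?this \<longleftrightarrow> ((\<lambda>n. 1 / pochhammer (real (n + a)) (m + 2)) has_sum h 0) {N<..}"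
    by (rule has_sum_reindex_bij_witness[of _ "\<lambda>n. n - Suc N" "\<lambda>i. i + Suc N"]) (auto simp: add_ac)
  finally show ?thesis
    by (simp add: h_def)
qed

subsection \<open>The summands of the rho values\<close>

definition rho_summand :: "nat \<Rightarrow> nat list \<Rightarrow> nat list \<Rightarrow> real" where
  "rho_summand a ks ns =
    (\<Prod>j<length ks. 1 / pochhammer (real (a + ns ! j + (\<Sum>i<j. ks ! i - 1))) (ks ! j))"

lemma rho_eq_infsum: "rho ks = infsum (rho_summand 0 ks) (increasing (length ks) 0)"
  unfolding rho_def rho_summand_def increasing_def by (simp add: Suc_le_eq)

lemma rho_summand_nonneg: "0 \<le> rho_summand a ks ns"
  unfolding rho_summand_def 
  by (intro prod_nonneg ballI) (simp add: pochhammer_prod prod_nonneg del: of_nat_add of_nat_sum)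

lemma rho_summand_Nil [simp]: "rho_summand a [] ns = 1"
  by (simp add: rho_summand_def)

text \<open>The first argument enters the shifts of all later factors, so removing it moves
  \<open>k - 1\<close> into \<open>a\<close>.\<close>

lemma rho_summand_Cons:
  "rho_summand a (k # ks) (n # ns) =
    1 / pochhammer (real (n + a)) k * rho_summand (a + (k - 1)) ks ns"
  unfolding rho_summand_def
  by (simp add: prod.lessThan_Suc_shift sum.lessThan_Suc_shift add_ac del: prod.lessThan_Suc sum.lessThan_Suc)

definition rho_args :: "nat list \<Rightarrow> nat list" where
  "rho_args s = map (\<lambda>x. x + 1) (butlast s) @ [last s + 2]"

lemma rho_args_Cons: "s \<noteq> [] \<Longrightarrow> rho_args (i # s) = Suc i # rho_args s"
  by (simp add: rho_args_def)

lemma has_sum_rho_summand: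
  "((\<lambda>ns. \<Sum>s\<in>compositions (Suc r) m. rho_summand a (rho_args s) ns) has_sum
     zeta_star_ones (m + 1) r / (real (m + 1) * pochhammer (real (N + a + 1)) (m + 1)))
   (increasing (Suc r) N)"
proof (induction r arbitrary: N a m)
  case 0
  show ?case
  proof (rule has_sum_increasing_Suc)
    fix n :: nat assume "N < n"
    \<comment> \<open>Depth one: the only composition is \<open>[m]\<close>, with argument m + 2,
      and nothing is left to sum after \<open>n\<close>.\<close>
    have "increasing 0 n = {[]}"
      by (auto simp: increasing_def)
    then show "((\<lambda>ns. \<Sum>s\<in>compositions (Suc 0) m. rho_summand a (rho_args s) (n # ns)) has_sum
        1 / pochhammer (real (n + a)) (m + 2)) (increasing 0 n)"
      using has_sum_finite[of "{[] :: nat list}" "\<lambda>_. 1 / pochhammer (real (n + a)) (m + 2)"]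
      by (simp add: compositions_1 rho_args_def rho_summand_Cons)
  qed (use has_sum_inverse_pochhammer[of a m N] in \<open>simp_all add: sum_nonneg rho_summand_nonneg\<close>)
next
  case (Suc r)
  show ?case
  proof (rule has_sum_increasing_Suc)
    fix n :: nat assume "N < n"
    then have n: "real (n + a) > 0"
      by simp
    \<comment> \<open>Here \<open>i\<close> is the first part of the composition; the induction
      hypothesis is used with lower bound \<open>n\<close>, shift \<open>a + i\<close> and total
      \<open>m - i\<close>.\<close>
    have "((\<lambda>ns. \<Sum>i\<le>m. 1 / pochhammer (real (n + a)) (Suc i) *
          (\<Sum>s\<in>compositions (Suc r) (m - i). rho_summand (a + i) (rho_args s) ns)) has_sum
        (\<Sum>i\<le>m. 1 / pochhammer (real (n + a)) (Suc i) * (zeta_star_ones (m - i + 1) r /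
          (real (m - i + 1) * pochhammer (real (n + (a + i) + 1)) (m - i + 1))))) (increasing (Suc r) n)"
      by (intro has_sum_sum has_sum_cmult_right Suc) simp
    also have "(\<lambda>ns. \<Sum>i\<le>m. 1 / pochhammer (real (n + a)) (Suc i) *
          (\<Sum>s\<in>compositions (Suc r) (m - i). rho_summand (a + i) (rho_args s) ns)) =
        (\<lambda>ns. \<Sum>s\<in>compositions (Suc (Suc r)) m. rho_summand a (rho_args s) (n # ns))"
    proof
      fix ns
      have "rho_summand a (rho_args (i # s)) (n # ns) =
          1 / pochhammer (real (n + a)) (Suc i) * rho_summand (a + i) (rho_args s) ns"
        if "s \<in> compositions (Suc r) (m - i)" for i s
      proof -
        have "s \<noteq> []"
          using that by (auto simp: compositions_def)
        then show ?thesis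
          by (simp add: rho_args_Cons rho_summand_Cons)
      qed
      then show "(\<Sum>i\<le>m. 1 / pochhammer (real (n + a)) (Suc i) *
          (\<Sum>s\<in>compositions (Suc r) (m - i). rho_summand (a + i) (rho_args s) ns)) =
        (\<Sum>s\<in>compositions (Suc (Suc r)) m. rho_summand a (rho_args s) (n # ns))"
        unfolding sum_compositions_Suc[where r = "Suc r"] sum_distrib_left by (intro sum.cong refl) simp
    qed
    also have "(\<Sum>i\<le>m. 1 / pochhammer (real (n + a)) (Suc i) * (zeta_star_ones (m - i + 1) r /
          (real (m - i + 1) * pochhammer (real (n + (a + i) + 1)) (m - i + 1)))) =
        (\<Sum>i\<le>m. zeta_star_ones (m - i + 1) r / real (m - i + 1)) *
          (1 / pochhammer (real (n + a)) (m + 2))"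
      unfolding sum_distrib_right
    proof (intro sum.cong refl)
      \<comment> \<open>With x = n + a, the factors (x)_{i+1} and (x+i+1)_{m-i+1} are consecutive
        pieces of (x)_{m+2}.\<close>
      fix i assume "i \<in> {..m}"
      then have "pochhammer (real (n + a)) (m + 2) =
          pochhammer (real (n + a)) (Suc i) * pochhammer (real (n + (a + i) + 1)) (m - i + 1)"
        using pochhammer_product'[of "real (n + a)" "Suc i" "m - i + 1"] by (simp add: add_ac)
      then show "1 / pochhammer (real (n + a)) (Suc i) * (zeta_star_ones (m - i + 1) r /
          (real (m - i + 1) * pochhammer (real (n + (a + i) + 1)) (m - i + 1))) =
        zeta_star_ones (m - i + 1) r / real (m - i + 1) * (1 / pochhammer (real (n + a)) (m + 2))"
        by simp
    qed
    \<comment> \<open>Substituting j = m + 1 - i gives the recursion over j = 1, ..., m + 1.\<close>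
    also have "(\<Sum>i\<le>m. zeta_star_ones (m - i + 1) r / real (m - i + 1)) = zeta_star_ones (m + 1) (Suc r)"
      unfolding zeta_star_ones_Suc
      by (rule sum.reindex_bij_witness[of _ "\<lambda>j. m + 1 - j" "\<lambda>i. m - i + 1"]) auto
    finally show "((\<lambda>ns. \<Sum>s\<in>compositions (Suc (Suc r)) m. rho_summand a (rho_args s) (n # ns)) has_sum
        zeta_star_ones (m + 1) (Suc r) * (1 / pochhammer (real (n + a)) (m + 2))) (increasing (Suc r) n)" .
  next
    show "((\<lambda>n. zeta_star_ones (m + 1) (Suc r) * (1 / pochhammer (real (n + a)) (m + 2))) has_sum
        zeta_star_ones (m + 1) (Suc r) / (real (m + 1) * pochhammer (real (N + a + 1)) (m + 1))) {N<..}"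
      using has_sum_cmult_right[OF has_sum_inverse_pochhammer[of a m N], of "zeta_star_ones (m + 1) (Suc r)"]
      by simp
  qed (simp add: sum_nonneg rho_summand_nonneg)
qed

theorem theorem2p2:
  fixes m r :: nat
  assumes "r \<ge> 1"
  shows "(\<Sum>s\<in>{s :: nat list. length s = r \<and> sum_list s = m}.
            rho (map (\<lambda>x. x + 1) (butlast s) @ [last s + 2]))
           = zeta_star_ones (m + 1) (r - 1) / (real (m + 1) * fact (m + 1))
       \<and> zeta_star_ones (m + 1) (r - 1) / (real (m + 1) * fact (m + 1))
           = 1 / (real (m + 1) * fact (m + 1)) * P (r - 1) (\<lambda>s. gen_harm (m + 1) s)"
proof
  obtain k where r: "r = Suc k"
    using assms by (cases r) auto
  have "(\<Sum>s\<in>compositions r m. rho (rho_args s)) =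
      (\<Sum>s\<in>compositions r m. infsum (rho_summand 0 (rho_args s)) (increasing r 0))"
    by (intro sum.cong refl) (auto simp: rho_eq_infsum rho_args_def compositions_def r)
  also have "\<dots> = zeta_star_ones (m + 1) k / (real (m + 1) * pochhammer (real (0 + 0 + 1)) (m + 1))"
    unfolding r by (rule sum_infsum_nonneg[OF finite_compositions has_sum_rho_summand])
      (rule rho_summand_nonneg)
  also have "pochhammer (real (0 + 0 + 1)) (m + 1) = fact (m + 1)"
    by (simp only: pochhammer_fact) simp
  finally show "(\<Sum>s\<in>{s :: nat list. length s = r \<and> sum_list s = m}.
        rho (map (\<lambda>x. x + 1) (butlast s) @ [last s + 2]))
      = zeta_star_ones (m + 1) (r - 1) / (real (m + 1) * fact (m + 1))"
    by (simp add: compositions_def rho_args_def r)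
  show "zeta_star_ones (m + 1) (r - 1) / (real (m + 1) * fact (m + 1))
      = 1 / (real (m + 1) * fact (m + 1)) * P (r - 1) (\<lambda>s. gen_harm (m + 1) s)"
    by (simp add: zeta_star_ones_eq_P)
qed

end
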